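(* As formal power series in $x,y$, $$\Phi(x,y;T)=2e^{y(e^x+1)+x}-\frac{y^2+2y}{2}e^{2x+2y}+(y^2-1)e^{x+2y}-e^x-\frac{y^2-2y+2}{2}e^{2y}+2.$$
   Context: A $(0,1)$-matrix is a matrix with all entries in $\{0,1\}$. A $2\times2$ submatrix of a matrix is obtained by choosing two rows $i_1<i_2$ and two columns $j_1<j_2$. Let $T=\begin{pmatrix}1&1\\0&0\end{pmatrix}$ and let $[T]=\left\{\begin{pmatrix}1&1\\0&0\end{pmatrix},\begin{pmatrix}0&0\\1&1\end{pmatrix}\right\}$ be its equivalence class under row and column exchanges. For $k,n\ge1$, $\phi(k,n;T)$ is the number of $k\times n$ $(0,1)$-matrices having no $2\times2$ submatrix in $[T]$. By convention $\phi(0,0;T)=1$ and $\phi(k,0;T)=\phi(0,n;T)=0$ for $k,n\ge1$. The generating function is $\Phi(x,y;T)=\sum_{n\ge0}\sum_{k\ge0}\phi(k,n;T)\frac{x^k}{k!}\frac{y^n}{n!}$. *)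

theory Defs
  imports
    "Jordan_Normal_Form.DL_Submatrix"
    "Jordan_Normal_Form.Column_Operations"
    "HOL-Computational_Algebra.Formal_Power_Series"
begin

(* Meant for 2 x 2 matrices, where the only nontrivial row (column) exchange is 0 <-> 1. *)
definition exchange_class :: "'a mat \<Rightarrow> 'a mat set" where
  "exchange_class M =
     {M, mat_swaprows 0 1 M, mat_swapcols 0 1 M, mat_swaprows 0 1 (mat_swapcols 0 1 M)}"

definition matT :: "nat mat" where
  "matT = mat_of_rows_list 2 [[1, 1], [0, 0]]"

lemma exchange_class_matT:
  "exchange_class matT =
     {mat_of_rows_list 2 [[1, 1], [0, 0]], mat_of_rows_list 2 [[0, 0], [1, 1]]}"
proof -
  have c: "mat_swapcols 0 1 matT = matT"
    by (rule eq_matI) (auto simp: matT_def mat_swapcols_def mat_of_rows_list_def less_Suc_eq)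
  have r: "mat_swaprows 0 1 matT = mat_of_rows_list 2 [[0, 0], [1, 1]]"
    by (rule eq_matI) (auto simp: matT_def mat_swaprows_def mat_of_rows_list_def less_Suc_eq)
  show ?thesis
    unfolding exchange_class_def c r by (auto simp: matT_def)
qed

definition has_2x2_submatrix_in :: "'a mat \<Rightarrow> 'a mat set \<Rightarrow> bool" where
  "has_2x2_submatrix_in A S \<longleftrightarrow>
     (\<exists>i1 i2 j1 j2. i1 < i2 \<and> i2 < dim_row A \<and> j1 < j2 \<and> j2 < dim_col A \<and>
        submatrix A {i1, i2} {j1, j2} \<in> S)"

(* For k = 0 or n = 0 the value is a convention and not the number of
   (trivially avoiding) k x n matrices, which would be 1. *)
definition phi :: "nat \<Rightarrow> nat \<Rightarrow> nat mat \<Rightarrow> nat" where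
  "phi k n M =
     (if k = 0 \<and> n = 0 then 1
      else if k = 0 \<or> n = 0 then 0
      else card {A \<in> carrier_mat k n.
                   elements_mat A \<subseteq> {0, 1} \<and> \<not> has_2x2_submatrix_in A (exchange_class M)})"

(* Bivariate power series in x, y are series in y whose coefficients are series in x:
   the coefficient of x^k y^n in F is fps_nth (fps_nth F n) k. *)
type_synonym bfps = "rat fps fps"

definition varX :: bfps where "varX = fps_const fps_X"
definition varY :: bfps where "varY = fps_X"
definition bconst :: "rat \<Rightarrow> bfps" where "bconst c = fps_const (fps_const c)"

(* exp F = \<Sum>i. F^i / i! for F with constant term 0.  By lemma bfps_power_nth_eq_0 the powers
   with i > k + n do not contribute to the coefficient of x^k y^n.  The exponent
   y (e^x + 1) + x, viewed as a series in y, has the nonzero constant term x, so fps_compose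
   with fps_exp would not give this series. *)
definition bexp :: "bfps \<Rightarrow> bfps" where
  "bexp F = Abs_fps (\<lambda>n. Abs_fps (\<lambda>k. \<Sum>i\<le>k + n. fps_nth (fps_nth (F ^ i) n) k / fact i))"

lemma bfps_power_nth_eq_0:
  fixes F :: bfps
  assumes "fps_nth (fps_nth F 0) 0 = 0" and "k + n < i"
  shows "fps_nth (fps_nth (F ^ i) n) k = 0"
  using assms(2)
proof (induction i arbitrary: n k)
  case 0
  then show ?case by simp
next
  case (Suc i)
  have "fps_nth (fps_nth F a) b * fps_nth (fps_nth (F ^ i) (n - a)) (k - b) = 0"
    if "a \<le> n" "b \<le> k" for a b
  proof (cases "a = 0 \<and> b = 0")
    case True
    then show ?thesis using assms(1) by simp
  next
    case False
    then have "(k - b) + (n - a) < i" using that Suc.prems by linarith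
    then show ?thesis using Suc.IH by simp
  qed
  then show ?case
    by (auto simp: fps_mult_nth fps_sum_nth intro!: sum.neutral simp del: mult_eq_0_iff)
qed

definition Phi :: "nat mat \<Rightarrow> bfps" where
  "Phi M = Abs_fps (\<lambda>n. Abs_fps (\<lambda>k. of_nat (phi k n M) / (fact k * fact n)))"

end

theory Submission
  imports Defs
begin

text \<open>
  Read the rows of a \<open>(0,1)\<close>-matrix with \<open>n\<close> columns as subsets of an \<open>n\<close>-set. Avoiding the class of
  \<open>T\<close> means that any two rows \<open>A\<close>, \<open>B\<close> are \<^emph>\<open>close\<close>: both \<open>A - B\<close> and \<open>B - A\<close> have at most one
  element (\<open>phi_eq_card_close_seqs\<close>). A family of pairwise close sets with at least two members has a
  very rigid shape: either it lies in an \<^emph>\<open>up-star\<close>, consisting of a centre \<open>C\<close> and the sets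
  \<open>C \<union> {i}\<close>, or it lies in a \<^emph>\<open>down-star\<close>, consisting of a centre \<open>D\<close> and the sets \<open>D - {i}\<close>
  (\<open>close_seqs_decomp\<close>). Any two distinct members \<open>A\<close>, \<open>B\<close> recover the centres as
  \<open>C = A \<inter> B\<close> and \<open>D = A \<union> B\<close>, and the two stars determined in this way meet only in \<open>A\<close> and \<open>B\<close>.

  Hence nonconstant sequences of \<open>k\<close> pairwise close sets are counted by adding, over all centres, the
  nonconstant sequences in the up-stars and in the down-stars, and subtracting the sequences counted
  twice, which are those with exactly two values. Adding the \<open>2^n\<close> constant sequences gives, for
  \<open>k, n \<ge> 1\<close>,
  \<open>phi k n = 2^n + 2 (\<Sum>m. (n choose m) ((m+1)^k - (m+1))) - (\<Sum>m. (n choose m) ((m+1) choose 2)) (2^k - 2)\<close>.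

  On the side of the series, every exponential has the form \<open>exp (c x + y h(x))\<close>,
  whose coefficient of \<open>y^n\<close> is \<open>e^(c x) h(x)^n / n!\<close> (\<open>bexp_linear\<close>). The leading term
  \<open>2 exp (y (e^x + 1) + x)\<close> yields the sum over stars by the binomial theorem, the terms in
  \<open>e^(2x+2y)\<close> and \<open>e^(x+2y)\<close> yield the corrections, and the remaining terms only adjust the
  coefficients with \<open>k = 0\<close> or \<open>n = 0\<close> to the convention for empty matrices.
\<close>

section \<open>Close sets and stars\<close>

definition at_most_one :: "'a set \<Rightarrow> bool" where
  "at_most_one S \<longleftrightarrow> (\<forall>x y. x \<in> S \<longrightarrow> y \<in> S \<longrightarrow> x = y)"

definition close :: "'a set \<Rightarrow> 'a set \<Rightarrow> bool" where
  "close A B \<longleftrightarrow> at_most_one (A - B) \<and> at_most_one (B - A)"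

definition up_star :: "'a set \<Rightarrow> 'a set \<Rightarrow> 'a set set" where
  "up_star N C = {X. C \<subseteq> X \<and> X \<subseteq> N \<and> at_most_one (X - C)}"

definition down_star :: "'a set \<Rightarrow> 'a set set" where
  "down_star D = {X. X \<subseteq> D \<and> at_most_one (D - X)}"

text \<open>Unfolding to membership turns the following facts on finitely many sets into monadic first-order
  problems with equality.\<close>

lemmas star_unfold = close_def at_most_one_def up_star_def down_star_def
  subset_iff set_eq_iff Diff_iff Int_iff Un_iff mem_Collect_eq

lemma close_refl: "close A A"
  by (simp add: close_def at_most_one_def)

lemma up_star_close: "A \<in> up_star N C \<Longrightarrow> B \<in> up_star N C \<Longrightarrow> close A B"
  unfolding star_unfold by (smt (verit))

lemma down_star_close: "A \<in> down_star D \<Longrightarrow> B \<in> down_star D \<Longrightarrow> close A B"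
  unfolding star_unfold by (smt (verit))

lemma up_star_centre: "A \<in> up_star N C \<Longrightarrow> B \<in> up_star N C \<Longrightarrow> A \<noteq> B \<Longrightarrow> C = A \<inter> B"
  unfolding star_unfold by (smt (verit))

lemma down_star_centre: "A \<in> down_star D \<Longrightarrow> B \<in> down_star D \<Longrightarrow> A \<noteq> B \<Longrightarrow> D = A \<union> B"
  unfolding star_unfold by (smt (verit))

lemma close_imp_mem_down_star: "close A B \<Longrightarrow> A \<in> down_star (A \<union> B)"
  unfolding star_unfold by (smt (verit))

text \<open>Such an \<open>E\<close> lies between \<open>A \<inter> B\<close> and \<open>A \<union> B\<close>, which differ by at most one element from each
  of \<open>A - B\<close> and \<open>B - A\<close>. If they differ by one element, they are \<open>A\<close> and \<open>B\<close> themselves. If they differ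
  by two, \<open>E\<close> can be neither of them, and only \<open>A\<close> and \<open>B\<close> remain.\<close>

lemma stars_inter_eq_pair:
  assumes "A \<noteq> B" "E \<in> up_star N (A \<inter> B)" "E \<in> down_star (A \<union> B)" "close A B"
  shows "E = A \<or> E = B"
  using assms unfolding star_unfold by (smt (verit))

text \<open>If \<open>E\<close> omits some \<open>c \<in> A \<inter> B\<close>, then \<open>c\<close> is its only omission from \<open>A\<close> and from \<open>B\<close>, and an
  element of \<open>E\<close> outside \<open>A \<union> B\<close> would force \<open>A = B\<close>; so \<open>E\<close> is in the down-star. If \<open>E\<close> contains
  \<open>A \<inter> B\<close> and two more elements, neither can be outside \<open>A \<union> B\<close>, since the other one would then have
  to lie in \<open>A \<inter> B\<close>; so they are the two elements of \<open>A \<union> B - A \<inter> B\<close>, and \<open>E = A \<union> B\<close>.\<close>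

lemma close_third:
  assumes "A \<noteq> B" "close A B" "close A E" "close B E" "E \<subseteq> N"
  shows "E \<in> up_star N (A \<inter> B) \<or> E \<in> down_star (A \<union> B)"
  using assms unfolding star_unfold by (smt (verit))

text \<open>A family of pairwise close sets through \<open>A\<close> and \<open>B\<close> cannot use both stars in an essential way:
  a set of the up-star only and one of the down-star only differ by two elements in one direction.\<close>

lemma close_excludes_mixed:
  assumes "close A B"
    and "E \<in> up_star N (A \<inter> B)" "E \<notin> down_star (A \<union> B)"
    and "E' \<in> down_star (A \<union> B)" "E' \<notin> up_star N (A \<inter> B)" "E' \<subseteq> N"
  shows "\<not> close E E'"
  using assms unfolding star_unfold by (smt (verit))

lemma card_up_star:
  assumes "finite N" "C \<subseteq> N"
  shows "card (up_star N C) = card (N - C) + 1" "finite (up_star N C)"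
proof -
  have eq: "up_star N C = insert C ((\<lambda>i. insert i C) ` (N - C))"
  proof (intro equalityI subsetI)
    fix X assume X: "X \<in> up_star N C"
    show "X \<in> insert C ((\<lambda>i. insert i C) ` (N - C))"
    proof (cases "X = C")
      case False
      then obtain i where "i \<in> X" "i \<notin> C" using X by (auto simp: up_star_def)
      then have "X = insert i C" "i \<in> N - C" using X unfolding star_unfold insert_iff by (smt (verit))+
      then show ?thesis by blast
    qed simp
  qed (use \<open>C \<subseteq> N\<close> in \<open>auto simp: up_star_def at_most_one_def\<close>)
  have "inj_on (\<lambda>i. insert i C) (N - C)" by (auto simp: inj_on_def)
  moreover have "C \<notin> (\<lambda>i. insert i C) ` (N - C)" by auto
  ultimately show "card (up_star N C) = card (N - C) + 1" "finite (up_star N C)"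
    using \<open>finite N\<close> by (simp_all add: eq card_image)
qed

lemma card_down_star:
  assumes "finite D"
  shows "card (down_star D) = card D + 1" "finite (down_star D)"
proof -
  have eq: "down_star D = insert D ((\<lambda>i. D - {i}) ` D)"
  proof (intro equalityI subsetI)
    fix X assume X: "X \<in> down_star D"
    show "X \<in> insert D ((\<lambda>i. D - {i}) ` D)"
    proof (cases "X = D")
      case False
      then obtain i where "i \<in> D" "i \<notin> X" using X by (auto simp: down_star_def)
      then have "X = D - {i}" using X unfolding star_unfold singleton_iff by (smt (verit))
      then show ?thesis using \<open>i \<in> D\<close> by blast
    qed simp
  qed (auto simp: down_star_def at_most_one_def)
  have "inj_on (\<lambda>i. D - {i}) D" by (auto simp: inj_on_def)
  moreover have "D \<notin> (\<lambda>i. D - {i}) ` D" by auto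
  ultimately show "card (down_star D) = card D + 1" "finite (down_star D)"
    using assms by (simp_all add: eq card_image)
qed

section \<open>Counting sequences of pairwise close sets\<close>

text \<open>Sequences of length \<open>k\<close> are extensional functions on \<open>{..<k}\<close>, so that they form a finite set.\<close>

definition nonconst :: "nat \<Rightarrow> 'a set \<Rightarrow> (nat \<Rightarrow> 'a) set" where
  "nonconst k X = {r \<in> {..<k} \<rightarrow>\<^sub>E X. \<exists>i<k. \<exists>j<k. r i \<noteq> r j}"

lemma nonconst_mem: "r \<in> nonconst k X \<Longrightarrow> i < k \<Longrightarrow> r i \<in> X"
  by (auto simp: nonconst_def)

lemma nonconst_obtain:
  assumes "r \<in> nonconst k X"
  obtains i j where "i < k" "j < k" "r i \<noteq> r j"
  using assms unfolding nonconst_def by blast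

lemma nonconst_subset:
  assumes "r \<in> nonconst k X" "\<And>i. i < k \<Longrightarrow> r i \<in> Y"
  shows "r \<in> nonconst k Y"
  using assms by (simp add: nonconst_def PiE_iff)

text \<open>A nonconstant sequence in both sets would give two distinct common elements. This is how distinct
  stars, and distinct pairs, come to contribute disjointly.\<close>

lemma nonconst_disjoint:
  assumes "\<And>A B. A \<in> X \<Longrightarrow> A \<in> Y \<Longrightarrow> B \<in> X \<Longrightarrow> B \<in> Y \<Longrightarrow> A = B"
  shows "nonconst k X \<inter> nonconst k Y = {}"
proof (intro equals0I)
  fix r assume "r \<in> nonconst k X \<inter> nonconst k Y"
  then have r: "r \<in> nonconst k X" "r \<in> nonconst k Y" by blast+
  obtain i j where "i < k" "j < k" "r i \<noteq> r j" by (rule nonconst_obtain[OF r(1)])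
  then show False using assms nonconst_mem[OF r(1)] nonconst_mem[OF r(2)] by blast
qed

definition const_seqs :: "nat \<Rightarrow> 'a set \<Rightarrow> (nat \<Rightarrow> 'a) set" where
  "const_seqs k X = ({..<k} \<rightarrow>\<^sub>E X) - nonconst k X"

lemma const_seqs_eq:
  assumes "k \<ge> 1" shows "const_seqs k X = (\<lambda>x. \<lambda>i\<in>{..<k}. x) ` X"
proof (intro equalityI subsetI)
  fix r assume "r \<in> const_seqs k X"
  then have PiE: "r \<in> {..<k} \<rightarrow>\<^sub>E X" and eq: "\<And>i j. i < k \<Longrightarrow> j < k \<Longrightarrow> r i = r j"
    unfolding const_seqs_def nonconst_def by blast+
  have const: "r i = r 0" if "i < k" for i
    using that assms by (intro eq) simp_all
  have "r = (\<lambda>i\<in>{..<k}. r 0)"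
  proof
    fix i show "r i = (\<lambda>i\<in>{..<k}. r 0) i"
      using PiE_arb[OF PiE, of i] const[of i] by (cases "i < k") simp_all
  qed
  moreover have "r 0 \<in> X" using PiE_mem[OF PiE, of 0] assms by simp
  ultimately show "r \<in> (\<lambda>x. \<lambda>i\<in>{..<k}. x) ` X" by blast
next
  fix r assume "r \<in> (\<lambda>x. \<lambda>i\<in>{..<k}. x) ` X"
  then obtain x where x: "x \<in> X" "r = (\<lambda>i\<in>{..<k}. x)" by blast
  then have "r i = x" if "i < k" for i using that by simp
  then have "r \<notin> nonconst k X" by (simp add: nonconst_def)
  moreover have "r \<in> {..<k} \<rightarrow>\<^sub>E X" using x by simp
  ultimately show "r \<in> const_seqs k X" by (simp add: const_seqs_def)
qed

lemma card_const_seqs: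
  assumes "k \<ge> 1" shows "card (const_seqs k X) = card X"
proof -
  have "inj_on (\<lambda>x. \<lambda>i\<in>{..<k}. x) X"
  proof (rule inj_onI)
    fix x y assume "(\<lambda>i\<in>{..<k}. x) = (\<lambda>i\<in>{..<k}. y)"
    from fun_cong[OF this, of 0] show "x = y" using assms by simp
  qed
  then show ?thesis by (simp add: const_seqs_eq[OF assms] card_image)
qed

lemma card_nonconst:
  assumes "finite X" "k \<ge> 1"
  shows "int (card (nonconst k X)) = int (card X) ^ k - int (card X)" "finite (nonconst k X)"
proof -
  have fin: "finite ({..<k} \<rightarrow>\<^sub>E X)" using assms by (intro finite_PiE) auto
  have sub: "nonconst k X \<subseteq> {..<k} \<rightarrow>\<^sub>E X" unfolding nonconst_def by blast
  then show "finite (nonconst k X)" using fin finite_subset by blast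
  have "card (const_seqs k X) + card (nonconst k X) = card ({..<k} \<rightarrow>\<^sub>E X)"
    unfolding const_seqs_def using card_Diff_subset[OF finite_subset[OF sub fin] sub] card_mono[OF fin sub] by linarith
  then have "card X + card (nonconst k X) = card X ^ k"
    using assms by (simp add: card_PiE card_const_seqs)
  then have "int (card X + card (nonconst k X)) = int (card X ^ k)" by (rule arg_cong)
  then show "int (card (nonconst k X)) = int (card X) ^ k - int (card X)" by simp
qed

definition close_seqs :: "nat \<Rightarrow> 'a set \<Rightarrow> (nat \<Rightarrow> 'a set) set" where
  "close_seqs k N = {r \<in> {..<k} \<rightarrow>\<^sub>E Pow N. \<forall>i<k. \<forall>j<k. close (r i) (r j)}"

text \<open>Pick two distinct members \<open>r a\<close> and \<open>r b\<close>. Every member lies in one of the two stars that they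
  determine (\<open>close_third\<close>), and no two members can lie in different stars exclusively
  (\<open>close_excludes_mixed\<close>), so a single star contains them all.\<close>

lemma close_seqs_decomp:
  "close_seqs k N = const_seqs k (Pow N) \<union>
     ((\<Union>C\<in>Pow N. nonconst k (up_star N C)) \<union> (\<Union>D\<in>Pow N. nonconst k (down_star D)))"
    (is "_ = ?K \<union> (?U \<union> ?D)")
proof (intro equalityI subsetI)
  fix r assume "r \<in> close_seqs k N"
  then have r: "r \<in> {..<k} \<rightarrow>\<^sub>E Pow N" and cl: "\<And>i j. i < k \<Longrightarrow> j < k \<Longrightarrow> close (r i) (r j)"
    by (auto simp: close_seqs_def)
  have rN: "r i \<subseteq> N" if "i < k" for i using r that by auto
  show "r \<in> ?K \<union> (?U \<union> ?D)"
  proof (cases "\<exists>i<k. \<exists>j<k. r i \<noteq> r j")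
    case False
    then have "r \<in> ?K" using r unfolding const_seqs_def nonconst_def by blast
    then show ?thesis by blast
  next
    case True
    then obtain a b where ab: "a < k" "b < k" "r a \<noteq> r b" by blast
    let ?C = "r a \<inter> r b" and ?D' = "r a \<union> r b"
    have "(\<forall>i<k. r i \<in> up_star N ?C) \<or> (\<forall>i<k. r i \<in> down_star ?D')"
    proof (rule ccontr)
      assume "\<not> ?thesis"
      then obtain i j where ij: "i < k" "r i \<notin> up_star N ?C" "j < k" "r j \<notin> down_star ?D'" by blast
      then have "r i \<in> down_star ?D'" "r j \<in> up_star N ?C"
        using close_third[of "r a" "r b" _ N] ab cl rN by blast+
      then have "\<not> close (r j) (r i)" using close_excludes_mixed[of "r a" "r b" "r j" N "r i"] ij ab cl rN by blast
      then show False using cl ij by blast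
    qed
    then have "r \<in> nonconst k (up_star N ?C) \<or> r \<in> nonconst k (down_star ?D')"
      using r True by (auto simp: nonconst_def PiE_iff)
    moreover have "?C \<in> Pow N" "?D' \<in> Pow N" using rN ab by blast+
    ultimately show ?thesis by blast
  qed
next
  fix r assume "r \<in> ?K \<union> (?U \<union> ?D)"
  then consider "r \<in> ?K" | C where "C \<subseteq> N" "r \<in> nonconst k (up_star N C)"
    | D where "D \<subseteq> N" "r \<in> nonconst k (down_star D)" by blast
  then show "r \<in> close_seqs k N"
  proof cases
    case 1
    then have r: "r \<in> {..<k} \<rightarrow>\<^sub>E Pow N" and eq: "\<And>i j. i < k \<Longrightarrow> j < k \<Longrightarrow> r i = r j"
      unfolding const_seqs_def nonconst_def by blast+
    have "close (r i) (r j)" if "i < k" "j < k" for i j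
      using eq[OF that] close_refl by metis
    then show ?thesis using r unfolding close_seqs_def by blast
  next
    case 2
    then have m: "r i \<in> up_star N C" if "i < k" for i using that nonconst_mem by blast
    have "r i \<in> Pow N" if "i < k" for i using m[OF that] by (simp add: up_star_def)
    moreover have "r \<in> {..<k} \<rightarrow>\<^sub>E up_star N C" using 2 by (simp add: nonconst_def)
    ultimately have "r \<in> {..<k} \<rightarrow>\<^sub>E Pow N" by (simp add: PiE_iff)
    then show ?thesis unfolding close_seqs_def using up_star_close[OF m m] by blast
  next
    case 3
    then have m: "r i \<in> down_star D" if "i < k" for i using that nonconst_mem by blast
    have "r i \<in> Pow N" if "i < k" for i using m[OF that] 3 by (auto simp: down_star_def)
    moreover have "r \<in> {..<k} \<rightarrow>\<^sub>E down_star D" using 3 by (simp add: nonconst_def)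
    ultimately have "r \<in> {..<k} \<rightarrow>\<^sub>E Pow N" by (simp add: PiE_iff)
    then show ?thesis unfolding close_seqs_def using down_star_close[OF m m] by blast
  qed
qed

text \<open>The sequences counted by both kinds of stars are those with exactly two values. Organising the
  pairs of values by the unique up-star containing them makes them easy to count.\<close>

lemma nonconst_stars_overlap:
  "(\<Union>C\<in>Pow N. nonconst k (up_star N C)) \<inter> (\<Union>D\<in>Pow N. nonconst k (down_star D))
    = (\<Union>C\<in>Pow N. \<Union>P\<in>{P. P \<subseteq> up_star N C \<and> card P = 2}. nonconst k P)"
proof (intro equalityI subsetI)
  fix r assume "r \<in> (\<Union>C\<in>Pow N. nonconst k (up_star N C)) \<inter> (\<Union>D\<in>Pow N. nonconst k (down_star D))"
  then obtain C D where CD: "C \<subseteq> N" "D \<subseteq> N" "r \<in> nonconst k (up_star N C)" "r \<in> nonconst k (down_star D)"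
    by blast
  then have m: "r i \<in> up_star N C" "r i \<in> down_star D" if "i < k" for i
    using that nonconst_mem by blast+
  obtain a b where ab: "a < k" "b < k" "r a \<noteq> r b" by (rule nonconst_obtain[OF CD(3)])
  have eq: "C = r a \<inter> r b" "D = r a \<union> r b"
    using up_star_centre[OF m(1)[OF ab(1)] m(1)[OF ab(2)] ab(3)]
      down_star_centre[OF m(2)[OF ab(1)] m(2)[OF ab(2)] ab(3)] by simp_all
  have "r i \<in> {r a, r b}" if "i < k" for i
    using stars_inter_eq_pair[of "r a" "r b" "r i" N] m[OF that] up_star_close[OF m(1)[OF ab(1)] m(1)[OF ab(2)]] ab
    unfolding eq by blast
  then have "r \<in> nonconst k {r a, r b}" by (rule nonconst_subset[OF CD(3)])
  moreover have "{r a, r b} \<subseteq> up_star N C" "card {r a, r b} = 2" using m ab by simp_all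
  ultimately show "r \<in> (\<Union>C\<in>Pow N. \<Union>P\<in>{P. P \<subseteq> up_star N C \<and> card P = 2}. nonconst k P)"
    using CD by blast
next
  fix r assume "r \<in> (\<Union>C\<in>Pow N. \<Union>P\<in>{P. P \<subseteq> up_star N C \<and> card P = 2}. nonconst k P)"
  then obtain C P where P: "C \<subseteq> N" "P \<subseteq> up_star N C" "card P = 2" "r \<in> nonconst k P" by blast
  obtain A B where AB: "P = {A, B}" "A \<noteq> B" using P(3) unfolding card_2_iff by blast
  have A: "A \<in> up_star N C" and B: "B \<in> up_star N C" using P(2) unfolding AB by simp_all
  have cl: "close A B" "close B A" using up_star_close A B by blast+
  have D: "P \<subseteq> down_star (A \<union> B)"
    using close_imp_mem_down_star[OF cl(1)] close_imp_mem_down_star[OF cl(2)] by (simp add: AB Un_commute)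
  have "A \<union> B \<subseteq> N" using A B by (simp add: up_star_def)
  moreover have "r \<in> nonconst k (up_star N C)" "r \<in> nonconst k (down_star (A \<union> B))"
    using P(2) D nonconst_mem[OF P(4)] by (auto intro!: nonconst_subset[OF P(4)])
  ultimately show "r \<in> (\<Union>C\<in>Pow N. nonconst k (up_star N C)) \<inter> (\<Union>D\<in>Pow N. nonconst k (down_star D))"
    using P by blast
qed

text \<open>Inclusion and exclusion for the two unions in \<open>close_seqs_decomp\<close>. Each union is disjoint, as
  is the description of their intersection, because two distinct values determine the centre.\<close>

lemma card_close_seqs:
  fixes N :: "'a set"
  assumes fin: "finite N" and k: "k \<ge> 1"
  shows "int (card (close_seqs k N)) = 2 ^ card N
    + (\<Sum>C\<in>Pow N. int (card (N - C) + 1) ^ k - int (card (N - C) + 1))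
    + (\<Sum>D\<in>Pow N. int (card D + 1) ^ k - int (card D + 1))
    - (\<Sum>C\<in>Pow N. int ((card (N - C) + 1) choose 2) * (2 ^ k - 2))"
proof -
  define U D V where "U = (\<Union>C\<in>Pow N. nonconst k (up_star N C))"
    and "D = (\<Union>C\<in>Pow N. nonconst k (down_star C))"
    and "V = (\<lambda>C. \<Union>P\<in>{P. P \<subseteq> up_star N C \<and> card P = 2}. nonconst k P)"
  have finsub: "finite C" if "C \<in> Pow N" for C using that fin finite_subset by blast
  have fup: "finite (up_star N C)" if "C \<in> Pow N" for C using card_up_star fin that by blast
  have up_disj: "nonconst k (up_star N C) \<inter> nonconst k (up_star N C') = {}" if "C \<noteq> C'" for C C' :: "'a set"
  proof (intro nonconst_disjoint, rule ccontr)
    fix A B assume "A \<in> up_star N C" "A \<in> up_star N C'" "B \<in> up_star N C" "B \<in> up_star N C'" "A \<noteq> B"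
    then have "C = A \<inter> B" "C' = A \<inter> B" by (simp_all add: up_star_centre)
    with that show False by simp
  qed
  have down_disj: "nonconst k (down_star C) \<inter> nonconst k (down_star C') = {}" if "C \<noteq> C'" for C C' :: "'a set"
  proof (intro nonconst_disjoint, rule ccontr)
    fix A B assume "A \<in> down_star C" "A \<in> down_star C'" "B \<in> down_star C" "B \<in> down_star C'" "A \<noteq> B"
    then have "C = A \<union> B" "C' = A \<union> B" by (simp_all add: down_star_centre)
    with that show False by simp
  qed
  have pair_disj: "nonconst k P \<inter> nonconst k P' = {}" if "P \<noteq> P'" "card P = 2" "card P' = 2"
    for P P' :: "'a set set"
  proof (intro nonconst_disjoint, rule ccontr)
    fix A B assume "A \<in> P" "A \<in> P'" "B \<in> P" "B \<in> P'" "A \<noteq> B"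
    then have "P = {A, B}" "P' = {A, B}" using that(2,3) unfolding card_2_iff by blast+
    with \<open>P \<noteq> P'\<close> show False by simp
  qed
  have V_sub: "V C \<subseteq> nonconst k (up_star N C)" for C
    unfolding V_def by (auto intro: nonconst_subset dest: nonconst_mem)
  have fin_up: "finite (nonconst k (up_star N C))" if "C \<in> Pow N" for C
    by (rule card_nonconst(2)[OF fup[OF that] k])
  have fin_down: "finite (nonconst k (down_star C))" if "C \<in> Pow N" for C
    by (rule card_nonconst(2)[OF card_down_star(2)[OF finsub[OF that]] k])
  have cardU: "card U = (\<Sum>C\<in>Pow N. card (nonconst k (up_star N C)))"
    unfolding U_def using fin fin_up up_disj by (intro card_UN_disjoint) auto
  have cardD: "card D = (\<Sum>C\<in>Pow N. card (nonconst k (down_star C)))"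
    unfolding D_def using fin fin_down down_disj by (intro card_UN_disjoint) auto
  have finU: "finite U" and finD: "finite D"
    unfolding U_def D_def using fin fin_up fin_down by blast+
  have cardV: "int (card (V C)) = int ((card (N - C) + 1) choose 2) * (2 ^ k - 2)" if C: "C \<in> Pow N" for C
  proof -
    let ?Ps = "{P. P \<subseteq> up_star N C \<and> card P = 2}"
    have fp: "finite P" if "P \<in> ?Ps" for P using that fup[OF C] finite_subset by blast
    have "finite ?Ps" using fup[OF C] by simp
    then have "card (V C) = (\<Sum>P\<in>?Ps. card (nonconst k P))"
      unfolding V_def using card_nonconst(2)[OF fp k] pair_disj
      by (intro card_UN_disjoint) blast+
    then have "int (card (V C)) = (\<Sum>P\<in>?Ps. 2 ^ k - 2)"
      using card_nonconst(1)[OF fp k] by simp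
    then show ?thesis
      using C fin n_subsets[OF fup[OF C], of 2] card_up_star[OF fin, of C] by (simp del: of_nat_Suc)
  qed
  have finV: "finite (V C)" if "C \<in> Pow N" for C
    using V_sub fin_up[OF that] finite_subset by blast
  have V_disj: "V C \<inter> V C' = {}" if "C \<noteq> C'" for C C'
    using V_sub[of C] V_sub[of C'] up_disj[OF that] by blast
  have "card (U \<inter> D) = card (\<Union>C\<in>Pow N. V C)" unfolding U_def D_def nonconst_stars_overlap V_def ..
  also have "\<dots> = (\<Sum>C\<in>Pow N. card (V C))"
    using fin finV V_disj by (intro card_UN_disjoint) auto
  finally have cardUD: "card (U \<inter> D) = (\<Sum>C\<in>Pow N. card (V C))" .
  have disj: "const_seqs k (Pow N) \<inter> (U \<union> D) = {}"
    unfolding U_def D_def const_seqs_def nonconst_def by blast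
  have "finite (const_seqs k (Pow N))" unfolding const_seqs_def
    using fin by (intro finite_subset[OF _ finite_PiE[of "{..<k}" "\<lambda>_. Pow N"]]) auto
  then have "card (close_seqs k N) = card (const_seqs k (Pow N)) + card (U \<union> D)"
    unfolding close_seqs_decomp using disj finU finD unfolding U_def D_def by (intro card_Un_disjoint) auto
  moreover have "card U + card D = card (U \<union> D) + card (U \<inter> D)"
    using finU finD by (rule card_Un_Int)
  ultimately have "int (card (close_seqs k N)) = 2 ^ card N + int (card U) + int (card D) - int (card (U \<inter> D))"
    using card_const_seqs[OF k, of "Pow N"] fin by (simp add: card_Pow)
  also have "int (card U) = (\<Sum>C\<in>Pow N. int (card (N - C) + 1) ^ k - int (card (N - C) + 1))"
    unfolding cardU of_nat_sum using fup k fin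
    by (intro sum.cong refl) (simp add: card_nonconst card_up_star)
  also have "int (card D) = (\<Sum>D\<in>Pow N. int (card D + 1) ^ k - int (card D + 1))"
    unfolding cardD of_nat_sum using finsub k
    by (intro sum.cong refl) (simp add: card_nonconst card_down_star)
  also have "int (card (U \<inter> D)) = (\<Sum>C\<in>Pow N. int ((card (N - C) + 1) choose 2) * (2 ^ k - 2))"
    unfolding cardUD of_nat_sum using cardV by (intro sum.cong refl)
  finally show ?thesis .
qed

section \<open>Sums over subsets by cardinality\<close>

lemma sum_complement:
  fixes f :: "nat \<Rightarrow> int"
  shows "(\<Sum>C\<in>Pow N. f (card (N - C))) = (\<Sum>C\<in>Pow N. f (card C))"
  by (rule sum.reindex_bij_witness[of _ "\<lambda>C. N - C" "\<lambda>C. N - C"]) (auto simp: double_diff)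

lemma sum_Pow_card:
  fixes f :: "nat \<Rightarrow> int"
  assumes "finite N"
  shows "(\<Sum>C\<in>Pow N. f (card C)) = (\<Sum>m\<le>card N. int (card N choose m) * f m)"
proof -
  have "(\<Sum>C\<in>Pow N. f (card C)) = (\<Sum>m\<le>card N. \<Sum>C | C \<in> Pow N \<and> card C = m. f (card C))"
    using assms by (intro sum.group[symmetric]) (auto intro: card_mono)
  also have "\<dots> = (\<Sum>m\<le>card N. int (card N choose m) * f m)"
    using assms by (intro sum.cong refl) (simp add: n_subsets)
  finally show ?thesis .
qed

lemma sum_Pow_insert:
  fixes f :: "nat \<Rightarrow> int"
  assumes "finite N" "a \<notin> N"
  shows "(\<Sum>C\<in>Pow (insert a N). f (card C)) = (\<Sum>C\<in>Pow N. f (card C)) + (\<Sum>C\<in>Pow N. f (Suc (card C)))"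
proof -
  have "(\<Sum>C\<in>Pow (insert a N). f (card C)) = (\<Sum>C\<in>Pow N. f (card C)) + (\<Sum>C\<in>insert a ` Pow N. f (card C))"
    unfolding Pow_insert using assms by (intro sum.union_disjoint) auto
  also have "(\<Sum>C\<in>insert a ` Pow N. f (card C)) = (\<Sum>C\<in>Pow N. f (card (insert a C)))"
    using assms by (intro sum.reindex_cong[of "insert a"]) (auto simp: inj_on_def)
  also have "\<dots> = (\<Sum>C\<in>Pow N. f (Suc (card C)))"
    using assms by (intro sum.cong refl) (auto simp: finite_subset card_insert_if)
  finally show ?thesis .
qed

lemma sum_Pow_linear:
  "finite N \<Longrightarrow> 2 * (\<Sum>C\<in>Pow N. int (card C + 1)) = (int (card N) + 2) * 2 ^ card N"
proof (induction N rule: finite_induct)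
  case (insert a N)
  then have "(\<Sum>C\<in>Pow (insert a N). int (card C + 1)) = 2 * (\<Sum>C\<in>Pow N. int (card C + 1)) + 2 ^ card N"
    using sum_Pow_insert[of N a "\<lambda>m. int (m + 1)"] by (simp add: sum.distrib card_Pow)
  then show ?case using insert by (simp add: algebra_simps)
qed simp

lemma sum_Pow_choose2:
  "finite N \<Longrightarrow> 8 * (\<Sum>C\<in>Pow N. int ((card C + 1) choose 2)) = int (card N) * (int (card N) + 3) * 2 ^ card N"
proof (induction N rule: finite_induct)
  case (insert a N)
  have "(Suc m + 1) choose 2 = ((m + 1) choose 2) + (m + 1)" for m
    by (simp add: numeral_2_eq_2)
  then have "(\<Sum>C\<in>Pow (insert a N). int ((card C + 1) choose 2))
     = 2 * (\<Sum>C\<in>Pow N. int ((card C + 1) choose 2)) + (\<Sum>C\<in>Pow N. int (card C + 1))"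
    using sum_Pow_insert[of N a "\<lambda>m. int ((m + 1) choose 2)"] insert by (simp add: sum.distrib)
  then show ?case using insert sum_Pow_linear[of N] by (simp add: algebra_simps)
qed simp

text \<open>The shape matches the closed form term by term: the coefficient of \<open>2^k\<close> comes from
  \<open>e^(2x+2y)\<close>, and the part independent of \<open>k\<close> from \<open>e^(x+2y)\<close>.\<close>

lemma card_close_seqs_formula:
  assumes fin: "finite N" and k: "k \<ge> 1" and n: "card N = n"
  shows "(of_nat (card (close_seqs k N)) :: rat) = 2 * (\<Sum>m\<le>n. of_nat (n choose m) * (of_nat m + 1) ^ k)
   - (of_nat n * (of_nat n + 3) / 8) * 2 ^ n * 2 ^ k
   + (of_nat n * (of_nat n - 1) / 4 - 1) * 2 ^ n"
proof -
  define S where "S = (\<Sum>m\<le>n. int (n choose m) * (int m + 1) ^ k)"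
  have S: "(\<Sum>C\<in>Pow N. int (card C + 1) ^ k) = S"
    using sum_Pow_card[OF fin, of "\<lambda>m. int (m + 1) ^ k"] by (simp add: S_def n add.commute)
  define L where "L = (\<Sum>C\<in>Pow N. int (card C + 1))"
  define Q where "Q = (\<Sum>C\<in>Pow N. int ((card C + 1) choose 2))"
  have "int (card (close_seqs k N)) = 2 ^ n + (S - L) + (S - L) - Q * (2 ^ k - 2)"
    unfolding card_close_seqs[OF fin k] sum_subtractf n
      sum_complement[of "\<lambda>m. int (m + 1) ^ k"] sum_complement[of "\<lambda>m. int (m + 1)"]
      sum_complement[of "\<lambda>m. int ((m + 1) choose 2) * (2 ^ k - 2)"]
    unfolding S by (simp only: L_def Q_def sum_distrib_right)
  then have "(of_nat (card (close_seqs k N)) :: rat) = of_int (2 ^ n + (S - L) + (S - L) - Q * (2 ^ k - 2))"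
    by (metis of_int_of_nat_eq)
  moreover have "2 * (of_int L :: rat) = (of_nat n + 2) * 2 ^ n"
    using arg_cong[OF sum_Pow_linear[OF fin], of "of_int :: int \<Rightarrow> rat"] unfolding L_def[symmetric] n by simp
  moreover have "8 * (of_int Q :: rat) = of_nat n * (of_nat n + 3) * 2 ^ n"
    using arg_cong[OF sum_Pow_choose2[OF fin], of "of_int :: int \<Rightarrow> rat"] unfolding Q_def[symmetric] n by simp
  then have "of_int Q = of_nat n * (of_nat n + 3) * 2 ^ n / (8 :: rat)" by simp
  moreover have "(of_int S :: rat) = (\<Sum>m\<le>n. of_nat (n choose m) * (of_nat m + 1) ^ k)" by (simp add: S_def)
  ultimately show ?thesis by (simp add: field_simps)
qed

section \<open>Coefficients of the exponentials\<close>

text \<open>The series \<open>exp (c x + y h(x))\<close>, expanded in powers of \<open>y\<close>.\<close>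

definition lin_exp :: "rat \<Rightarrow> rat fps \<Rightarrow> bfps" where
  "lin_exp c h = Abs_fps (\<lambda>n. fps_const (1 / fact n) * fps_exp c * h ^ n)"

text \<open>The powers of the exponent are expanded by the binomial theorem. The coefficient of \<open>y^n\<close> in the
  \<open>i\<close>-th power is \<open>(i choose n) (c x)^(i - n) h^n\<close>, which contributes to \<open>x^k\<close> only for
  \<open>n \<le> i \<le> k + n\<close>; so the truncation at \<open>i \<le> k + n\<close> loses nothing.\<close>

lemma bexp_linear:
  "bexp (fps_const (fps_const c * fps_X) + fps_X * fps_const h)
     = lin_exp c h"
proof (intro fps_ext)
  fix n k
  let ?g = "fps_const c * fps_X :: rat fps"
  have coeff: "fps_nth ((fps_const ?g + fps_X * fps_const h) ^ i) n
      = of_nat (i choose n) * ?g ^ (i - n) * h ^ n" for i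
  proof -
    have "(fps_const ?g + fps_X * fps_const h) ^ i
        = (\<Sum>j\<le>i. of_nat (i choose j) * (fps_X * fps_const h) ^ j * fps_const ?g ^ (i - j))"
      by (subst add.commute) (rule binomial_ring)
    also have "fps_nth \<dots> n = (\<Sum>j\<le>i. if j = n then of_nat (i choose n) * ?g ^ (i - n) * h ^ n else 0)"
      unfolding fps_sum_nth
      by (rule sum.cong)
        (auto simp: power_mult_distrib mult.assoc fps_of_nat[symmetric] fps_X_power_mult_nth mult_ac
              fps_const_power fps_const_mult simp del: fps_of_nat)
    also have "\<dots> = of_nat (i choose n) * ?g ^ (i - n) * h ^ n"
      by (simp add: binomial_eq_0)
    finally show ?thesis .
  qed
  have "fps_nth (fps_nth (bexp (fps_const ?g + fps_X * fps_const h)) n) k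
     = (\<Sum>i\<le>k + n. fps_nth (of_nat (i choose n) * ?g ^ (i - n) * h ^ n) k / fact i)"
    by (simp add: bexp_def coeff)
  also have "\<dots> = (\<Sum>i\<in>{n..k + n}. fps_nth (of_nat (i choose n) * ?g ^ (i - n) * h ^ n) k / fact i)"
    by (rule sum.mono_neutral_right) (auto simp: binomial_eq_0)
  also have "\<dots> = (\<Sum>j\<le>k. fps_nth (of_nat ((j + n) choose n) * ?g ^ j * h ^ n) k / fact (j + n))"
    by (rule sum.reindex_bij_witness[of _ "\<lambda>j. j + n" "\<lambda>i. i - n"]) auto
  also have "\<dots> = (\<Sum>j\<le>k. 1 / fact n * (c ^ j / fact j) * fps_nth (h ^ n) (k - j))"
  proof (rule sum.cong[OF refl])
    fix j assume "j \<in> {..k}"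
    then have "fps_nth (of_nat ((j + n) choose n) * ?g ^ j * h ^ n) k
       = of_nat ((j + n) choose n) * c ^ j * fps_nth (h ^ n) (k - j)"
      by (simp add: power_mult_distrib fps_const_power mult.assoc fps_of_nat[symmetric] fps_X_power_mult_nth
          del: fps_of_nat)
    moreover have "(of_nat ((j + n) choose n) :: rat) / fact (j + n) = 1 / fact n * (1 / fact j)"
      by (simp add: binomial_fact)
    ultimately show "fps_nth (of_nat ((j + n) choose n) * ?g ^ j * h ^ n) k / fact (j + n)
       = 1 / fact n * (c ^ j / fact j) * fps_nth (h ^ n) (k - j)"
      by (simp add: field_simps)
  qed
  also have "\<dots> = fps_nth (fps_const (1 / fact n) * fps_exp c * h ^ n) k"
    unfolding mult.assoc fps_mult_left_const_nth fps_mult_nth[of "fps_exp c"]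
    by (simp add: sum_distrib_left sum_distrib_right atLeast0AtMost mult.assoc sum_divide_distrib)
  finally show "fps_nth (fps_nth (bexp (fps_const ?g + fps_X * fps_const h)) n) k
     = fps_nth (fps_nth (lin_exp c h) n) k"
    by (simp add: lin_exp_def)
qed

lemma bexp_x: "bexp varX = fps_const (fps_exp 1)"
  using bexp_linear[of 1 0] by (auto simp: varX_def lin_exp_def fps_eq_iff power_0_left)

lemma bexp_exponents:
  "bexp (varY * (bexp varX + 1) + varX) = lin_exp 1 (fps_exp 1 + 1)"
  "bexp (2 * varX + 2 * varY) = lin_exp 2 2"
  "bexp (varX + 2 * varY) = lin_exp 1 2"
  "bexp (2 * varY) = lin_exp 0 2"
proof -
  have two: "(2::bfps) = fps_const 2" "(2::rat fps) = fps_const 2"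
    by (simp_all only: fps_numeral_fps_const)
  show "bexp (varY * (bexp varX + 1) + varX) = lin_exp 1 (fps_exp 1 + 1)"
    unfolding bexp_linear[symmetric] bexp_x
    by (simp add: varX_def varY_def add.commute fps_const_add[symmetric] del: fps_const_add)
  show "bexp (2 * varX + 2 * varY) = lin_exp 2 2"
    "bexp (varX + 2 * varY) = lin_exp 1 2"
    "bexp (2 * varY) = lin_exp 0 2"
    unfolding bexp_linear[symmetric] by (simp_all add: varX_def varY_def two mult.commute)
qed

text \<open>For \<open>h = 2\<close>, multiplication by \<open>y\<close> acts on the coefficients as a scalar, since
  \<open>2^(n-1) / (n-1)! = (n / 2) (2^n / n!)\<close>. The factor \<open>n\<close> also covers \<open>n = 0\<close>.\<close>

lemma varY_mult_lin_exp: "fps_nth (varY * lin_exp c 2) n = fps_const (of_nat n / 2) * fps_nth (lin_exp c 2) n"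
proof (cases n)
  case (Suc m)
  have "fps_const (of_nat n / 2) * fps_nth (lin_exp c 2) n
      = (fps_const (of_nat n / 2) * fps_const (1 / fact n) * 2) * (fps_exp c * 2 ^ m)"
    by (simp add: lin_exp_def Suc mult_ac)
  also have "fps_const (of_nat n / 2) * fps_const (1 / fact n) * 2 = fps_const (1 / fact m :: rat)"
  proof -
    have "of_nat n / 2 * (1 / fact n) * 2 = (1 / fact m :: rat)"
      unfolding Suc fact_Suc by (simp del: of_nat_Suc)
    then show ?thesis by (simp add: fps_numeral_fps_const)
  qed
  finally show ?thesis by (simp add: varY_def lin_exp_def Suc mult_ac)
qed (simp add: varY_def)

lemma varY2_mult_lin_exp: "fps_nth (varY^2 * lin_exp c 2) n = fps_const (of_nat n * (of_nat n - 1) / 4) * fps_nth (lin_exp c 2) n"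
proof (cases n)
  case (Suc m)
  have "fps_nth (varY^2 * lin_exp c 2) n = fps_nth (varY * lin_exp c 2) m"
    by (simp add: power2_eq_square mult.assoc Suc varY_def)
  also have "\<dots> = fps_const (of_nat m / 2) * fps_nth (lin_exp c 2) m" by (rule varY_mult_lin_exp)
  also have "fps_nth (lin_exp c 2) m = fps_nth (varY * lin_exp c 2) n"
    by (simp add: varY_def Suc)
  also have "\<dots> = fps_const (of_nat n / 2) * fps_nth (lin_exp c 2) n" by (rule varY_mult_lin_exp)
  finally show ?thesis by (simp add: Suc mult.assoc[symmetric] field_simps)
qed (simp add: varY_def power2_eq_square mult.assoc)

lemma nth_lin_exp_exp: "fps_nth (fps_nth (lin_exp 1 (fps_exp 1 + 1)) n) k =
   (\<Sum>m\<le>n. of_nat (n choose m) * (of_nat m + 1) ^ k) / (fact k * fact n)"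
proof -
  have "fps_exp 1 * (fps_exp 1 + 1) ^ n = (\<Sum>m\<le>n. of_nat (n choose m) * fps_exp (of_nat m + 1 :: rat))"
    by (simp add: binomial_ring sum_distrib_left fps_exp_power_mult fps_exp_add_mult mult_ac)
  then have "fps_nth (fps_exp 1 * (fps_exp 1 + 1) ^ n) k = (\<Sum>m\<le>n. of_nat (n choose m) * ((of_nat m + 1) ^ k / fact k) :: rat)"
    by (simp add: fps_sum_nth fps_of_nat[symmetric] del: fps_of_nat)
  then show ?thesis
    by (simp add: lin_exp_def mult.assoc sum_divide_distrib divide_divide_eq_left' del: of_nat_Suc)
qed

lemma nth_lin_exp_2: "fps_nth (fps_nth (lin_exp c 2) n) k = 2 ^ n * c ^ k / (fact k * fact n)"
  by (simp add: lin_exp_def fps_numeral_fps_const mult.assoc fps_const_power mult.commute)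

lemma closed_form_coeff:
  "fps_nth (fps_nth (2 * bexp (varY * (bexp varX + 1) + varX)
    - bconst (1/2) * (varY^2 + 2 * varY) * bexp (2 * varX + 2 * varY)
    + (varY^2 - 1) * bexp (varX + 2 * varY)
    - bexp varX
    - bconst (1/2) * (varY^2 - 2 * varY + 2) * bexp (2 * varY)
    + 2) n) k * (fact k * fact n) =
   2 * (\<Sum>m\<le>n. of_nat (n choose m) * (of_nat m + 1) ^ k)
   - (of_nat n * (of_nat n + 3) / 8) * 2 ^ n * 2 ^ k
   + (of_nat n * (of_nat n - 1) / 4 - 1) * 2 ^ n
   - (if n = 0 then 1 else 0)
   - (if k = 0 then 2 ^ n * (of_nat n * (of_nat n - 1) / 8 - of_nat n / 2 + 1) else 0)
   + (if n = 0 \<and> k = 0 then 2 else 0)" (is "?l * ?f = ?r")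
proof -
  have f0: "?f \<noteq> (0::rat)" by simp
  have e: "c * (Y2 + 2 * Y) * B = c * (Y2 * B + 2 * (Y * B))"
    "(Y2 - 1) * B = Y2 * B - B"
    "c * (Y2 - 2 * Y + 2) * B = c * (Y2 * B - 2 * (Y * B) + 2 * B)" for c Y2 Y B :: bfps
    by (simp_all add: algebra_simps)
  have cancel: "f \<noteq> 0 \<Longrightarrow> (2 * (S / f) - 1 / 2 * (a * (p / f) + 2 * (b * (p / f))) + (a * (q / f) - q / f) - u / f
      - 1 / 2 * (a * (z / f) - 2 * (b * (z / f)) + 2 * (z / f)) + w / f) * f
    = 2 * S - 1 / 2 * (a * p + 2 * (b * p)) + (a * q - q) - u - 1 / 2 * (a * z - 2 * (b * z) + 2 * z) + w"
    for f S a b p q u z w :: rat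
    by (simp add: field_simps)
  have two: "(2::bfps) = fps_const (fps_const 2)"
    by (simp only: fps_numeral_fps_const)
  have "?l = 2 * ((\<Sum>m\<le>n. of_nat (n choose m) * (of_nat m + 1) ^ k) / ?f)
    - 1 / 2 * (of_nat n * (of_nat n - 1) / 4 * (2 ^ n * 2 ^ k / ?f) + 2 * (of_nat n / 2 * (2 ^ n * 2 ^ k / ?f)))
    + (of_nat n * (of_nat n - 1) / 4 * (2 ^ n * 1 ^ k / ?f) - (2 ^ n * 1 ^ k / ?f))
    - (if n = 0 then 1 else 0) / ?f
    - 1 / 2 * (of_nat n * (of_nat n - 1) / 4 * (2 ^ n * 0 ^ k / ?f) - 2 * (of_nat n / 2 * (2 ^ n * 0 ^ k / ?f)) + 2 * (2 ^ n * 0 ^ k / ?f))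
    + (if n = 0 \<and> k = 0 then 2 else 0) / ?f"
    unfolding bexp_exponents unfolding bexp_x e bconst_def unfolding two
    by (simp add: varY_mult_lin_exp varY2_mult_lin_exp nth_lin_exp_exp nth_lin_exp_2 del: of_nat_Suc)
  then have "?l * ?f = 2 * (\<Sum>m\<le>n. of_nat (n choose m) * (of_nat m + 1) ^ k)
    - 1 / 2 * (of_nat n * (of_nat n - 1) / 4 * (2 ^ n * 2 ^ k) + 2 * (of_nat n / 2 * (2 ^ n * 2 ^ k)))
    + (of_nat n * (of_nat n - 1) / 4 * (2 ^ n * 1 ^ k) - (2 ^ n * 1 ^ k))
    - (if n = 0 then 1 else 0)
    - 1 / 2 * (of_nat n * (of_nat n - 1) / 4 * (2 ^ n * 0 ^ k) - 2 * (of_nat n / 2 * (2 ^ n * 0 ^ k)) + 2 * (2 ^ n * 0 ^ k))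
    + (if n = 0 \<and> k = 0 then 2 else 0)"
    by (simp only: cancel[OF f0])
  also have "\<dots> = ?r" by (cases "k = 0") (simp_all add: power_0_left field_simps)
  finally show ?thesis .
qed

section \<open>Matrices as sequences of close sets\<close>

lemma submatrix_2x2:
  assumes "i1 < i2" "i2 < dim_row A" "j1 < j2" "j2 < dim_col A"
  shows "submatrix A {i1, i2} {j1, j2} =
    mat 2 2 (\<lambda>(a, b). A $$ (if a = 0 then i1 else i2, if b = 0 then j1 else j2))"
proof -
  have pick: "pick {a, b} 0 = a" "pick {a, b} (Suc 0) = b" if "a < b" for a b :: nat
  proof -
    show a: "pick {a, b} 0 = a" using that by (auto intro!: Least_equality)
    show "pick {a, b} (Suc 0) = b"
      using that unfolding pick.simps(2) a by (auto intro!: Least_equality)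
  qed
  have card: "card {i. i < m \<and> i \<in> {a, b}} = 2" if "a < b" "b < m" for a b m :: nat
  proof -
    have "{i. i < m \<and> i \<in> {a, b}} = {a, b}" using that by auto
    then show ?thesis using that by simp
  qed
  show ?thesis
    unfolding submatrix_def card[OF assms(1,2)] card[OF assms(3,4)]
    using pick[OF assms(1)] pick[OF assms(3)] by (intro eq_matI) (auto simp: less_2_cases_iff)
qed

lemma mat_2x2_eq_iff:
  "mat 2 2 f = mat_of_rows_list 2 [[a, b], [c, d]] \<longleftrightarrow>
    f (0, 0) = a \<and> f (0, 1) = b \<and> f (1, 0) = c \<and> f (1, 1) = d" (is "?L = ?R \<longleftrightarrow> ?E")
proof
  assume "?L = ?R"
  then have "?L $$ (i, j) = ?R $$ (i, j)" for i j by simp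
  from this[of 0 0] this[of 0 1] this[of 1 0] this[of 1 1] show ?E
    by (simp add: mat_of_rows_list_def)
next
  assume ?E
  then show "?L = ?R"
    by (intro eq_matI) (auto simp: mat_of_rows_list_def numeral_2_eq_2 less_Suc_eq)
qed

text \<open>Both members of the class of \<open>T\<close> are absorbed by letting the two rows, and the two columns,
  occur in either order.\<close>

lemma has_submatrix_T_iff:
  "has_2x2_submatrix_in A (exchange_class matT) \<longleftrightarrow>
    (\<exists>i1<dim_row A. \<exists>i2<dim_row A. \<exists>j1<dim_col A. \<exists>j2<dim_col A. j1 \<noteq> j2 \<and>
       A $$ (i1, j1) = 1 \<and> A $$ (i1, j2) = 1 \<and> A $$ (i2, j1) = 0 \<and> A $$ (i2, j2) = 0)"
    (is "_ \<longleftrightarrow> ?R")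
proof -
  have T: "mat 2 2 f \<in> exchange_class matT \<longleftrightarrow>
     f (0,0) = 1 \<and> f (0,1) = 1 \<and> f (1,0) = 0 \<and> f (1,1) = 0 \<or>
     f (0,0) = 0 \<and> f (0,1) = 0 \<and> f (1,0) = 1 \<and> f (1,1) = 1" for f :: "nat \<times> nat \<Rightarrow> nat"
    unfolding exchange_class_matT insert_iff mat_2x2_eq_iff by simp
  have "has_2x2_submatrix_in A (exchange_class matT) \<longleftrightarrow>
    (\<exists>i1 i2 j1 j2. i1 < i2 \<and> i2 < dim_row A \<and> j1 < j2 \<and> j2 < dim_col A \<and>
     (A $$ (i1, j1) = 1 \<and> A $$ (i1, j2) = 1 \<and> A $$ (i2, j1) = 0 \<and> A $$ (i2, j2) = 0 \<or>
      A $$ (i1, j1) = 0 \<and> A $$ (i1, j2) = 0 \<and> A $$ (i2, j1) = 1 \<and> A $$ (i2, j2) = 1))" (is "_ \<longleftrightarrow> ?M")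
    unfolding has_2x2_submatrix_in_def by (intro ex_cong1 conj_cong refl) (simp add: submatrix_2x2 T)
  also have "?M \<longleftrightarrow> ?R"
  proof
    assume ?M
    then obtain i1 i2 j1 j2 where *: "i1 < i2" "i2 < dim_row A" "j1 < j2" "j2 < dim_col A"
      and vals: "A $$ (i1, j1) = 1 \<and> A $$ (i1, j2) = 1 \<and> A $$ (i2, j1) = 0 \<and> A $$ (i2, j2) = 0 \<or>
        A $$ (i1, j1) = 0 \<and> A $$ (i1, j2) = 0 \<and> A $$ (i2, j1) = 1 \<and> A $$ (i2, j2) = 1"
      by blast
    have "i1 < dim_row A" "j1 < dim_col A" "j1 \<noteq> j2" using * by simp_all
    with * vals show ?R by blast
  next
    assume ?R
    then obtain i1 i2 j1 j2 where *: "i1 < dim_row A" "i2 < dim_row A" "j1 < dim_col A" "j2 < dim_col A"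
       "j1 \<noteq> j2" "A $$ (i1, j1) = 1" "A $$ (i1, j2) = 1" "A $$ (i2, j1) = 0" "A $$ (i2, j2) = 0" by blast
    then have "i1 \<noteq> i2" by auto
    with * show ?M by (metis linorder_neqE_nat)
  qed
  finally show ?thesis .
qed

text \<open>A submatrix in the class of \<open>T\<close> is a pair of columns in which one row is all ones and another all
  zeros, that is, two elements of the difference of two row sets.\<close>

lemma phi_eq_card_close_seqs:
  assumes "k \<ge> 1" "n \<ge> 1"
  shows "phi k n matT = card (close_seqs k {..<n})"
proof -
  let ?M = "{A \<in> carrier_mat k n. elements_mat A \<subseteq> {0, 1} \<and> \<not> has_2x2_submatrix_in A (exchange_class matT)}"
  let ?f = "\<lambda>A :: nat mat. \<lambda>i\<in>{..<k}. {j. j < n \<and> A $$ (i, j) = 1}"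
  let ?g = "\<lambda>r. mat k n (\<lambda>(i, j). if j \<in> r i then 1 else 0) :: nat mat"
  have "bij_betw ?f ?M (close_seqs k {..<n})"
  proof (rule bij_betw_byWitness[where f' = ?g])
    have val: "A $$ (i, j) = 0 \<or> A $$ (i, j) = 1" if "A \<in> ?M" "i < k" "j < n" for A i j
      using that elements_matI[of A k n i j] by blast
    show "\<forall>A\<in>?M. ?g (?f A) = A"
      using val by (force intro!: eq_matI)
    show "\<forall>r\<in>close_seqs k {..<n}. ?f (?g r) = r"
    proof
      fix r assume "r \<in> close_seqs k {..<n}"
      then have r: "r \<in> {..<k} \<rightarrow>\<^sub>E Pow {..<n}" by (simp add: close_seqs_def)
      show "?f (?g r) = r"
      proof
        fix i show "?f (?g r) i = r i"
        proof (cases "i < k")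
          case True
          then have "r i \<subseteq> {..<n}" using r by auto
          with True show ?thesis by (auto split: if_splits)
        next
          case False
          then show ?thesis using PiE_arb[OF r, of i] by simp
        qed
      qed
    qed
    show "?f ` ?M \<subseteq> close_seqs k {..<n}"
    proof
      fix r assume "r \<in> ?f ` ?M"
      then obtain A where A: "A \<in> ?M" "r = ?f A" by blast
      have zero: "A $$ (i, j) = 0" if "i < k" "j < n" "A $$ (i, j) \<noteq> 1" for i j
        using val[OF A(1)] that by blast
      have "at_most_one (r i - r i')" if ii: "i < k" "i' < k" for i i'
      proof (unfold at_most_one_def, intro allI impI, rule ccontr)
        fix x y assume "x \<in> r i - r i'" "y \<in> r i - r i'" "x \<noteq> y"
        with ii A(2) have xy: "x < n" "y < n" "x \<noteq> y" "A $$ (i, x) = 1" "A $$ (i, y) = 1"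
          "A $$ (i', x) \<noteq> 1" "A $$ (i', y) \<noteq> 1" by auto
        have "A $$ (i', x) = 0" "A $$ (i', y) = 0" using zero[OF ii(2)] xy by blast+
        moreover have "dim_row A = k" "dim_col A = n" using A(1) by auto
        ultimately have "has_2x2_submatrix_in A (exchange_class matT)"
          unfolding has_submatrix_T_iff using ii xy by blast
        with A show False by blast
      qed
      then show "r \<in> close_seqs k {..<n}" using A by (auto simp: close_seqs_def close_def)
    qed
    show "?g ` close_seqs k {..<n} \<subseteq> ?M"
    proof (rule image_subsetI)
      fix r assume r: "r \<in> close_seqs k {..<n}"
      define G where "G = ?g r"
      have dim: "dim_row G = k" "dim_col G = n" by (simp_all add: G_def)
      have G: "j \<in> r i" if "i < k" "j < n" "G $$ (i, j) = 1" for i j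
        using that by (simp add: G_def split: if_splits)
      have G': "j \<notin> r i" if "i < k" "j < n" "G $$ (i, j) = 0" for i j
        using that by (simp add: G_def split: if_splits)
      have "\<not> has_2x2_submatrix_in G (exchange_class matT)"
      proof
        assume "has_2x2_submatrix_in G (exchange_class matT)"
        then obtain i1 i2 j1 j2 where *: "i1 < k" "i2 < k" "j1 < n" "j2 < n" "j1 \<noteq> j2"
          "G $$ (i1, j1) = 1" "G $$ (i1, j2) = 1" "G $$ (i2, j1) = 0" "G $$ (i2, j2) = 0"
          unfolding has_submatrix_T_iff dim by blast
        then have "j1 \<in> r i1 - r i2" "j2 \<in> r i1 - r i2" using G G' by blast+
        moreover have "at_most_one (r i1 - r i2)" using r *(1,2) unfolding close_seqs_def close_def by blast
        ultimately show False using \<open>j1 \<noteq> j2\<close> unfolding at_most_one_def by blast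
      qed
      then have "\<not> has_2x2_submatrix_in (?g r) (exchange_class matT)" by (simp only: G_def not_False_eq_True)
      moreover have "elements_mat (?g r) \<subseteq> {0, 1}" by (auto dest!: elements_matD split: if_splits)
      ultimately show "?g r \<in> ?M" by simp
    qed
  qed
  then show ?thesis using assms by (simp add: phi_def bij_betw_same_card)
qed

section \<open>The generating function\<close>

theorem mainTheorem5:
  shows "Phi matT =
      2 * bexp (varY * (bexp varX + 1) + varX)
    - bconst (1/2) * (varY^2 + 2 * varY) * bexp (2 * varX + 2 * varY)
    + (varY^2 - 1) * bexp (varX + 2 * varY)
    - bexp varX
    - bconst (1/2) * (varY^2 - 2 * varY + 2) * bexp (2 * varY)
    + 2" (is "_ = ?R")
proof (intro fps_ext)
  fix n k
  have choose_sum: "(\<Sum>m\<le>n. of_nat (n choose m)) = (2 ^ n :: rat)"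
    unfolding of_nat_sum[symmetric] choose_row_sum by simp
  have "of_nat (phi k n matT) = fps_nth (fps_nth ?R n) k * (fact k * fact n)"
  proof (cases "k = 0 \<or> n = 0")
    case True
    then show ?thesis
      unfolding closed_form_coeff by (auto simp: phi_def choose_sum field_simps)
  next
    case False
    then have "1 \<le> k" "1 \<le> n" by auto
    with card_close_seqs_formula[of "{..<n}" k n] show ?thesis
      unfolding closed_form_coeff by (simp add: phi_eq_card_close_seqs)
  qed
  then show "fps_nth (fps_nth (Phi matT) n) k = fps_nth (fps_nth ?R n) k"
    by (simp add: Phi_def)
qed
end
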